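(* Let $\mathsf{l2v}$ be the Cedille term of type $\forall A{:}\star.\ \Pi xs{:}\mathsf{List}\cdot A.\ \mathsf{Vec}\cdot A\ (\mathsf{length}\cdot A\ xs)$, coercing inductive lists to inductive vectors, defined in the context. Then its erasure is the identity function: $|\mathsf{l2v}| =_{\alpha\beta\eta}\lambda x.\,x$.
   Context: **Terms and erasure.** Terms are those of Cedille (type theory $\iota\lambda P2$), a type-annotated Curry-style dependent type theory. $\star$ is the kind of types; $\lambda x.\,t$ and $t\ t'$ are explicit abstraction and application (types $\Pi x{:}T.\,T'$, or $T\to T'$); $\Lambda x.\,t$ is implicit (erased) abstraction over a value or a type (types $\forall x{:}T.\,T'$, or $T\Rightarrow T'$ if non-dependent), with implicit value application $t\ {-}t'$ and type application $t\cdot T$; $[t,t']$, $t.1$, $t.2$ are the introduction and projections of the dependent intersection type $\iota x{:}T.\,T'$; $\beta$ and $\beta\{t\}$ are reflexivity proofs of the heterogeneous equality type $t_1\simeq t_2$; $\rho\ q - t$ is $t$ with its type rewritten by the equality proof $q$; $\varsigma\ q$ is symmetry of $q$. Erasure $|\cdot|$ maps annotated terms to untyped $\lambda$-terms: $|x|=x$, $|\lambda x.t|=\lambda x.|t|$, $|t\ t'|=|t|\ |t'|$, $|\Lambda x.t|=|t|$, $|t\ {-}t'|=|t|$, $|t\cdot T|=|t|$, $|[t,t']|=|t|$, $|t.1|=|t.2|=|t|$, $|\beta\{t\}|=|t|$, $|\beta|=\lambda x.x$, $|\rho\ q - t|=|t|$. Defined constants are unfolded. Erased terms are compared up to $\alpha\beta\eta$-equality.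 Type information does not affect erasure. **Lists.** $\mathsf{ListC}\cdot A=\forall X{:}\star.\ X\to(A\to X\to X)\to X$; $\mathsf{nilCL}=\Lambda A,X.\lambda c_N,c_C.\,c_N$; $\mathsf{consCL}=\Lambda A.\lambda x,xs.\Lambda X.\lambda c_N,c_C.\ c_C\ x\ (xs\cdot X\ c_N\ c_C)$; $\mathsf{ListP}\cdot A\ xsC=\forall X{:}\star.\forall P{:}X\to\star.\forall c_N{:}X.\forall c_C{:}A\to X\to X.\ P\ c_N\to(\forall xs{:}X.\Pi x{:}A.\ P\ xs\to P(c_C\ x\ xs))\to P(xsC\cdot X\ c_N\ c_C)$; $\mathsf{ListR}\cdot A\ xsC=(xsC\cdot(\mathsf{ListC}\cdot A)\ \mathsf{nilCL}\ \mathsf{consCL}\simeq xsC)$; $\mathsf{List}\cdot A=\iota xs{:}(\iota xsC{:}\mathsf{ListC}\cdot A.\ \mathsf{ListP}\cdot A\ xsC).\ \mathsf{ListR}\cdot A\ xs.1$. With $\mathsf{nilL},\mathsf{consL}$ the constructors of $\mathsf{List}$, the eliminator $\mathsf{elimList}:\forall A{:}\star.\Pi xs{:}\mathsf{List}\cdot A.\forall P{:}\mathsf{List}\cdot A\to\star.\ P(\mathsf{nilL}\cdot A)\to(\forall xs{:}\mathsf{List}\cdot A.\Pi x{:}A.\ P\ xs\to P(\mathsf{consL}\cdot A\ x\ xs))\to P\ xs$ is $\Lambda A.\lambda xs.\Lambda P.\ \rho\ (\varsigma\ xs.2)-(xs.1.2\cdot(\mathsf{List}\cdot A)\cdot P\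 {-}(\mathsf{nilL}\cdot A)\ {-}(\mathsf{consL}\cdot A))$. $\mathsf{length}:\forall A{:}\star.\mathsf{List}\cdot A\to\mathsf{Nat}$ is the usual length function. **Vectors.** $\mathsf{Nat}$ is the type of naturals with $\mathsf{zero},\mathsf{suc}$. $\mathsf{VecC}\cdot A\ n=\forall X{:}\mathsf{Nat}\to\star.\ X\ \mathsf{zero}\to(\forall n{:}\mathsf{Nat}.\ A\to X\ n\to X(\mathsf{suc}\ n))\to X\ n$; $\mathsf{nilCV}=\Lambda A,X.\lambda c_N,c_C.\,c_N$; $\mathsf{consCV}=\Lambda A,n.\lambda x,xs.\Lambda X.\lambda c_N,c_C.\ c_C\ {-}n\ x\ (xs\cdot X\ c_N\ c_C)$; $\mathsf{VecP}\cdot A\ n\ xsC=\forall X{:}\mathsf{Nat}\to\star.\forall P{:}\Pi n{:}\mathsf{Nat}.X\ n\to\star.\forall c_N{:}X\ \mathsf{zero}.\forall c_C{:}(\forall n{:}\mathsf{Nat}.A\to X\ n\to X(\mathsf{suc}\ n)).\ P\ \mathsf{zero}\ c_N\to(\forall n{:}\mathsf{Nat}.\forall xs{:}X\ n.\Pi x{:}A.\ P\ n\ xs\to P(\mathsf{suc}\ n)(c_C\ {-}n\ x\ xs))\to P\ n\ (xsC\cdot X\ c_N\ c_C)$; $\mathsf{VecR}\cdot A\ n\ xsC=(xsC\cdot(\mathsf{VecC}\cdot A)\ \mathsf{nilCV}\ \mathsf{consCV}\simeq xsC)$; $\mathsf{Vec}\cdot A\ n=\iota xs{:}(\iota xsC{:}\mathsf{VecC}\cdot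 A\ n.\ \mathsf{VecP}\cdot A\ n\ xsC).\ \mathsf{VecR}\cdot A\ n\ xs.1$. Helper: $\mathsf{mkVec}:\forall A.\forall n.\Pi xs{:}(\iota xsC{:}\mathsf{VecC}\cdot A\ n.\mathsf{VecP}\cdot A\ n\ xsC).\ \mathsf{VecR}\cdot A\ n\ xs.1\Rightarrow\mathsf{Vec}\cdot A\ n$ is $\Lambda A.\Lambda n.\lambda xs.\Lambda q.\,[xs,\ \rho\ q-\beta\{xs\}]$. **The coercion.** $\mathsf{l2vC}:\forall A.\Pi xs{:}\mathsf{List}\cdot A.\ \mathsf{VecC}\cdot A\ (\mathsf{length}\cdot A\ xs)$ is $\Lambda A.\lambda xs.\Lambda X.\lambda c_N.\lambda c_C.\ \mathsf{elimList}\cdot A\ xs\cdot(\lambda xs{:}\mathsf{List}\cdot A.\ X(\mathsf{length}\cdot A\ xs))\ c_N\ (\Lambda xs.\ c_C\ {-}(\mathsf{length}\cdot A\ xs))$. $\mathsf{l2vP}:\forall A.\Pi xs{:}\mathsf{List}\cdot A.\ \mathsf{VecP}\cdot A\ (\mathsf{length}\cdot A\ xs)\ (\mathsf{l2vC}\cdot A\ xs)$ is $\Lambda A.\lambda xs.\Lambda X.\Lambda P.\Lambda c_N.\Lambda c_C.\lambda p_N.\lambda p_C.\ \mathsf{elimList}\cdot A\ xs\cdot(\lambda xs{:}\mathsf{List}\cdot A.\ P(\mathsf{length}\cdot A\ xs)(\mathsf{l2vC}\cdot A\ xs\cdot X\ c_N\ c_C))\ p_N\ (\Lambda xs.\ p_C\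 {-}(\mathsf{length}\cdot A\ xs)\ {-}(\mathsf{l2vC}\cdot A\ xs\cdot X\ c_N\ c_C))$. $\mathsf{l2vR}:\forall A.\Pi xs{:}\mathsf{List}\cdot A.\ \mathsf{VecR}\cdot A\ (\mathsf{length}\cdot A\ xs)\ (\mathsf{l2vC}\cdot A\ xs)$ is $\Lambda A.\lambda xs.\ xs.2$. $\mathsf{l2v}=\Lambda A.\lambda xs.\ \mathsf{mkVec}\cdot A\ {-}(\mathsf{length}\cdot A\ xs)\ [\mathsf{l2vC}\cdot A\ xs,\ \mathsf{l2vP}\cdot A\ xs]\ {-}(\mathsf{l2vR}\cdot A\ xs)$. *)

theory Defs
  imports Main
begin

section \<open>Annotated terms, types and kinds\<close>

text \<open>
  Raw Cedille syntax with named variables. Term variables (\<open>Var\<close>) and type variables (\<open>TVar\<close>)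
  live in separate name spaces. \<open>ILam\<close> is the implicit abstraction over a value or over a type;
  its bound name can then occur as \<open>Var\<close> or as \<open>TVar\<close> respectively.
\<close>

type_synonym name = string

datatype trm =
    Var name
  | Lam name trm          (\<open>(\<open>notation=\<open>binder Lam\<close>\<close>\<^bold>\<lambda>_./ _)\<close> [1000, 60] 60)
  | ILam name trm         (\<open>(\<open>notation=\<open>binder ILam\<close>\<close>\<^bold>\<Lambda>_./ _)\<close> [1000, 60] 60)
  | App trm trm           (infixl \<open>\<bullet>\<close> 100)
  | IApp trm trm          (infixl \<open>\<ominus>\<close> 100)
  | TApp trm ty           (infixl \<open>\<cdot>\<close> 100)
  | IPair trm trm         (\<open>\<langle>_,/ _\<rangle>\<close>)
  | Proj1 trm
  | Proj2 trm
  | Beta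
  | BetaW trm             (\<open>\<beta>\<lbrace>_\<rbrace>\<close>)
  | Rho trm trm           (\<open>(\<open>notation=\<open>mixfix Rho\<close>\<close>\<rho> _ -/ _)\<close> [101, 101] 100)
  | Sym trm               (\<open>\<sigma> _\<close> [101] 100)
and ty =
    TVar name
  | TLam name ty ty       (\<open>(\<open>notation=\<open>binder TLam\<close>\<close>\<^bold>\<lambda>_ : _./ _)\<close> [1000, 61, 60] 60)
  | TLamK name knd ty     (\<open>(\<open>notation=\<open>binder TLamK\<close>\<close>\<^bold>\<lambda>_ \<Colon> _./ _)\<close> [1000, 61, 60] 60)
  | TAppV ty trm          (infixl \<open>\<bullet>\<^sub>v\<close> 100)
  | TAppT ty ty           (infixl \<open>\<cdot>\<^sub>t\<close> 100)
  | TPi name ty ty        (\<open>(\<open>notation=\<open>binder TPi\<close>\<close>\<^bold>\<Pi>_ : _./ _)\<close> [1000, 61, 60] 60)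
  | TAll name ty ty       (\<open>(\<open>notation=\<open>binder TAll\<close>\<close>\<^bold>\<forall>_ : _./ _)\<close> [1000, 61, 60] 60)
  | TAllK name knd ty     (\<open>(\<open>notation=\<open>binder TAllK\<close>\<close>\<^bold>\<forall>_ \<Colon> _./ _)\<close> [1000, 61, 60] 60)
  | TIota name ty ty      (\<open>(\<open>notation=\<open>binder TIota\<close>\<close>\<^bold>\<iota>_ : _./ _)\<close> [1000, 61, 60] 60)
  | TEq trm trm           (infix \<open>\<simeq>\<close> 90)
and knd =
    Star                  (\<open>\<star>\<close>)
  | KPi name ty knd
  | KPiK name knd knd

text \<open>Non-dependent arrows bind the name \<open>''_''\<close>, which is never used as a variable.\<close>

abbreviation TArr :: "ty \<Rightarrow> ty \<Rightarrow> ty"  (infixr \<open>\<rightarrow>\<close> 65)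
  where "T \<rightarrow> T' \<equiv> \<^bold>\<Pi>''_'' : T. T'"

abbreviation KArr :: "ty \<Rightarrow> knd \<Rightarrow> knd"  (infixr \<open>\<rightarrow>\<^sub>k\<close> 65)
  where "T \<rightarrow>\<^sub>k k \<equiv> KPi ''_'' T k"


section \<open>Untyped terms and \<open>\<alpha>\<beta>\<eta>\<close>-equality\<close>

datatype lam =
    LVar name
  | LLam name lam
  | LApp lam lam

primrec FV :: "lam \<Rightarrow> name set" where
  "FV (LVar x) = {x}"
| "FV (LLam x t) = FV t - {x}"
| "FV (LApp t u) = FV t \<union> FV u"

text \<open>
  \<open>lsubst x s t\<close> replaces the free occurrences of \<open>x\<close> in \<open>t\<close> by \<open>s\<close> without renaming; it is only
  used under \<open>free_for s x t\<close>, which says that no free variable of \<open>s\<close> gets captured. Modulo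
  \<open>\<alpha>\<close>-conversion (which is a rule of the equality below) this restriction loses nothing.
\<close>

primrec lsubst :: "name \<Rightarrow> lam \<Rightarrow> lam \<Rightarrow> lam" where
  "lsubst x s (LVar y) = (if y = x then s else LVar y)"
| "lsubst x s (LLam y t) = (if y = x then LLam y t else LLam y (lsubst x s t))"
| "lsubst x s (LApp t u) = LApp (lsubst x s t) (lsubst x s u)"

primrec free_for :: "lam \<Rightarrow> name \<Rightarrow> lam \<Rightarrow> bool" where
  "free_for s x (LVar y) \<longleftrightarrow> True"
| "free_for s x (LLam y t) \<longleftrightarrow> x \<notin> FV (LLam y t) \<or> (y \<notin> FV s \<and> free_for s x t)"
| "free_for s x (LApp t u) \<longleftrightarrow> free_for s x t \<and> free_for s x u"

inductive abe_eq :: "lam \<Rightarrow> lam \<Rightarrow> bool"  (infix \<open>=\<^sub>\<alpha>\<^sub>\<beta>\<^sub>\<eta>\<close> 50) where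
  alpha: "y \<notin> FV t \<Longrightarrow> free_for (LVar y) x t \<Longrightarrow> LLam x t =\<^sub>\<alpha>\<^sub>\<beta>\<^sub>\<eta> LLam y (lsubst x (LVar y) t)"
| beta: "free_for s x t \<Longrightarrow> LApp (LLam x t) s =\<^sub>\<alpha>\<^sub>\<beta>\<^sub>\<eta> lsubst x s t"
| eta: "x \<notin> FV t \<Longrightarrow> LLam x (LApp t (LVar x)) =\<^sub>\<alpha>\<^sub>\<beta>\<^sub>\<eta> t"
| refl: "t =\<^sub>\<alpha>\<^sub>\<beta>\<^sub>\<eta> t"
| sym: "t =\<^sub>\<alpha>\<^sub>\<beta>\<^sub>\<eta> u \<Longrightarrow> u =\<^sub>\<alpha>\<^sub>\<beta>\<^sub>\<eta> t"
| trans: "t =\<^sub>\<alpha>\<^sub>\<beta>\<^sub>\<eta> u \<Longrightarrow> u =\<^sub>\<alpha>\<^sub>\<beta>\<^sub>\<eta> v \<Longrightarrow> t =\<^sub>\<alpha>\<^sub>\<beta>\<^sub>\<eta> v"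
| lam: "t =\<^sub>\<alpha>\<^sub>\<beta>\<^sub>\<eta> t' \<Longrightarrow> LLam x t =\<^sub>\<alpha>\<^sub>\<beta>\<^sub>\<eta> LLam x t'"
| app: "t =\<^sub>\<alpha>\<^sub>\<beta>\<^sub>\<eta> t' \<Longrightarrow> u =\<^sub>\<alpha>\<^sub>\<beta>\<^sub>\<eta> u' \<Longrightarrow> LApp t u =\<^sub>\<alpha>\<^sub>\<beta>\<^sub>\<eta> LApp t' u'"


section \<open>Erasure\<close>

text \<open>
  Dropping the binder of \<open>\<^bold>\<Lambda>x. t\<close> relies on the side condition of Cedille's typing rule that \<open>x\<close>
  is not free in the erasure of \<open>t\<close>. An equality proof \<open>\<sigma> q\<close> erases like \<open>q\<close>, as in Cedille.
\<close>

primrec erase :: "trm \<Rightarrow> lam" where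
  "erase (Var x) = LVar x"
| "erase (\<^bold>\<lambda>x. t) = LLam x (erase t)"
| "erase (\<^bold>\<Lambda>x. t) = erase t"
| "erase (t \<bullet> u) = LApp (erase t) (erase u)"
| "erase (t \<ominus> u) = erase t"
| "erase (t \<cdot> T) = erase t"
| "erase \<langle>t, u\<rangle> = erase t"
| "erase (Proj1 t) = erase t"
| "erase (Proj2 t) = erase t"
| "erase Beta = LLam ''x'' (LVar ''x'')"
| "erase \<beta>\<lbrace>t\<rbrace> = erase t"
| "erase (\<rho> q - t) = erase t"
| "erase (\<sigma> q) = erase q"


section \<open>Natural numbers\<close>

text \<open>
  From here on each Cedille definition is a closed raw term or type, so that using the corresponding
  constant inside another one is exactly its unfolding, without any danger of capture.

  The naturals are derived by the same intersection-type recipe as the lists below. They only occur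
  inside types and implicit arguments of the coercion, hence never in its erasure.
\<close>

definition NatC :: ty where
  "NatC = \<^bold>\<forall>''X'' \<Colon> \<star>. TVar ''X'' \<rightarrow> (TVar ''X'' \<rightarrow> TVar ''X'') \<rightarrow> TVar ''X''"

definition zeroC :: trm where
  "zeroC = \<^bold>\<Lambda>''X''. \<^bold>\<lambda>''cZ''. \<^bold>\<lambda>''cS''. Var ''cZ''"

definition sucC :: trm where
  "sucC = \<^bold>\<lambda>''n''. \<^bold>\<Lambda>''X''. \<^bold>\<lambda>''cZ''. \<^bold>\<lambda>''cS''.
     Var ''cS'' \<bullet> (Var ''n'' \<cdot> TVar ''X'' \<bullet> Var ''cZ'' \<bullet> Var ''cS'')"

definition NatP :: ty where
  "NatP = \<^bold>\<lambda>''nC'' : NatC. \<^bold>\<forall>''X'' \<Colon> \<star>. \<^bold>\<forall>''P'' \<Colon> TVar ''X'' \<rightarrow>\<^sub>k \<star>.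
     \<^bold>\<forall>''cZ'' : TVar ''X''. \<^bold>\<forall>''cS'' : (TVar ''X'' \<rightarrow> TVar ''X'').
       TVar ''P'' \<bullet>\<^sub>v Var ''cZ'' \<rightarrow>
       (\<^bold>\<forall>''n'' : TVar ''X''. TVar ''P'' \<bullet>\<^sub>v Var ''n'' \<rightarrow> TVar ''P'' \<bullet>\<^sub>v (Var ''cS'' \<bullet> Var ''n'')) \<rightarrow>
       TVar ''P'' \<bullet>\<^sub>v (Var ''nC'' \<cdot> TVar ''X'' \<bullet> Var ''cZ'' \<bullet> Var ''cS'')"

definition NatR :: ty where
  "NatR = \<^bold>\<lambda>''nC'' : NatC. Var ''nC'' \<cdot> NatC \<bullet> zeroC \<bullet> sucC \<simeq> Var ''nC''"

definition NatT :: ty where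
  "NatT = \<^bold>\<iota>''n'' : (\<^bold>\<iota>''nC'' : NatC. NatP \<bullet>\<^sub>v Var ''nC''). NatR \<bullet>\<^sub>v Proj1 (Var ''n'')"

definition zeroN :: trm where
  "zeroN = \<langle>\<langle>zeroC,
     \<^bold>\<Lambda>''X''. \<^bold>\<Lambda>''P''. \<^bold>\<Lambda>''cZ''. \<^bold>\<Lambda>''cS''. \<^bold>\<lambda>''pZ''. \<^bold>\<lambda>''pS''. Var ''pZ''\<rangle>,
     \<beta>\<lbrace>zeroC\<rbrace>\<rangle>"

definition sucN :: trm where
  "sucN = \<^bold>\<lambda>''n''. \<langle>\<langle>sucC \<bullet> Proj1 (Proj1 (Var ''n'')),
     \<^bold>\<Lambda>''X''. \<^bold>\<Lambda>''P''. \<^bold>\<Lambda>''cZ''. \<^bold>\<Lambda>''cS''. \<^bold>\<lambda>''pZ''. \<^bold>\<lambda>''pS''.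
       Var ''pS'' \<ominus> (Proj1 (Proj1 (Var ''n'')) \<cdot> TVar ''X'' \<bullet> Var ''cZ'' \<bullet> Var ''cS'') \<bullet>
         (Proj2 (Proj1 (Var ''n'')) \<cdot> TVar ''X'' \<cdot> TVar ''P'' \<ominus> Var ''cZ'' \<ominus> Var ''cS''
            \<bullet> Var ''pZ'' \<bullet> Var ''pS'')\<rangle>,
     \<rho> (Proj2 (Var ''n'')) - \<beta>\<lbrace>sucC \<bullet> Proj1 (Proj1 (Var ''n''))\<rbrace>\<rangle>"


section \<open>Lists\<close>

definition ListC :: ty where
  "ListC = \<^bold>\<lambda>''A'' \<Colon> \<star>. \<^bold>\<forall>''X'' \<Colon> \<star>.
     TVar ''X'' \<rightarrow> (TVar ''A'' \<rightarrow> TVar ''X'' \<rightarrow> TVar ''X'') \<rightarrow> TVar ''X''"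

definition nilCL :: trm where
  "nilCL = \<^bold>\<Lambda>''A''. \<^bold>\<Lambda>''X''. \<^bold>\<lambda>''cN''. \<^bold>\<lambda>''cC''. Var ''cN''"

definition consCL :: trm where
  "consCL = \<^bold>\<Lambda>''A''. \<^bold>\<lambda>''x''. \<^bold>\<lambda>''xs''. \<^bold>\<Lambda>''X''. \<^bold>\<lambda>''cN''. \<^bold>\<lambda>''cC''.
     Var ''cC'' \<bullet> Var ''x'' \<bullet> (Var ''xs'' \<cdot> TVar ''X'' \<bullet> Var ''cN'' \<bullet> Var ''cC'')"

definition ListP :: ty where
  "ListP = \<^bold>\<lambda>''A'' \<Colon> \<star>. \<^bold>\<lambda>''xsC'' : ListC \<cdot>\<^sub>t TVar ''A''.
     \<^bold>\<forall>''X'' \<Colon> \<star>. \<^bold>\<forall>''P'' \<Colon> TVar ''X'' \<rightarrow>\<^sub>k \<star>.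
     \<^bold>\<forall>''cN'' : TVar ''X''. \<^bold>\<forall>''cC'' : (TVar ''A'' \<rightarrow> TVar ''X'' \<rightarrow> TVar ''X'').
       TVar ''P'' \<bullet>\<^sub>v Var ''cN'' \<rightarrow>
       (\<^bold>\<forall>''xs'' : TVar ''X''. \<^bold>\<Pi>''x'' : TVar ''A''.
          TVar ''P'' \<bullet>\<^sub>v Var ''xs'' \<rightarrow> TVar ''P'' \<bullet>\<^sub>v (Var ''cC'' \<bullet> Var ''x'' \<bullet> Var ''xs'')) \<rightarrow>
       TVar ''P'' \<bullet>\<^sub>v (Var ''xsC'' \<cdot> TVar ''X'' \<bullet> Var ''cN'' \<bullet> Var ''cC'')"

definition ListR :: ty where
  "ListR = \<^bold>\<lambda>''A'' \<Colon> \<star>. \<^bold>\<lambda>''xsC'' : ListC \<cdot>\<^sub>t TVar ''A''.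
     Var ''xsC'' \<cdot> (ListC \<cdot>\<^sub>t TVar ''A'') \<bullet> (nilCL \<cdot> TVar ''A'') \<bullet> (consCL \<cdot> TVar ''A'')
       \<simeq> Var ''xsC''"

definition ListT :: ty where
  "ListT = \<^bold>\<lambda>''A'' \<Colon> \<star>.
     \<^bold>\<iota>''xs'' : (\<^bold>\<iota>''xsC'' : ListC \<cdot>\<^sub>t TVar ''A''. ListP \<cdot>\<^sub>t TVar ''A'' \<bullet>\<^sub>v Var ''xsC'').
       ListR \<cdot>\<^sub>t TVar ''A'' \<bullet>\<^sub>v Proj1 (Var ''xs'')"

text \<open>
  \<open>nilL : \<forall>A:\<star>. List\<cdot>A\<close> and \<open>consL : \<forall>A:\<star>. A \<rightarrow> List\<cdot>A \<rightarrow> List\<cdot>A\<close>. The erasures of the three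
  components of each intersection agree up to \<open>\<alpha>\<beta>\<eta>\<close>, as dependent intersection requires.
\<close>

definition nilL :: trm where
  "nilL = \<^bold>\<Lambda>''A''. \<langle>\<langle>nilCL \<cdot> TVar ''A'',
     \<^bold>\<Lambda>''X''. \<^bold>\<Lambda>''P''. \<^bold>\<Lambda>''cN''. \<^bold>\<Lambda>''cC''. \<^bold>\<lambda>''pN''. \<^bold>\<lambda>''pC''. Var ''pN''\<rangle>,
     \<beta>\<lbrace>nilCL \<cdot> TVar ''A''\<rbrace>\<rangle>"

definition consL :: trm where
  "consL = \<^bold>\<Lambda>''A''. \<^bold>\<lambda>''x''. \<^bold>\<lambda>''xs''.
     \<langle>\<langle>consCL \<cdot> TVar ''A'' \<bullet> Var ''x'' \<bullet> Proj1 (Proj1 (Var ''xs'')),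
     \<^bold>\<Lambda>''X''. \<^bold>\<Lambda>''P''. \<^bold>\<Lambda>''cN''. \<^bold>\<Lambda>''cC''. \<^bold>\<lambda>''pN''. \<^bold>\<lambda>''pC''.
       Var ''pC'' \<ominus> (Proj1 (Proj1 (Var ''xs'')) \<cdot> TVar ''X'' \<bullet> Var ''cN'' \<bullet> Var ''cC'') \<bullet> Var ''x'' \<bullet>
         (Proj2 (Proj1 (Var ''xs'')) \<cdot> TVar ''X'' \<cdot> TVar ''P'' \<ominus> Var ''cN'' \<ominus> Var ''cC''
            \<bullet> Var ''pN'' \<bullet> Var ''pC'')\<rangle>,
     \<rho> (Proj2 (Var ''xs'')) -
       \<beta>\<lbrace>consCL \<cdot> TVar ''A'' \<bullet> Var ''x'' \<bullet> Proj1 (Proj1 (Var ''xs''))\<rbrace>\<rangle>"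

text \<open>
  \<open>elimList : \<forall>A:\<star>. \<Pi>xs:List\<cdot>A. \<forall>P:List\<cdot>A\<rightarrow>\<star>. P (nilL\<cdot>A) \<rightarrow>
    (\<forall>xs:List\<cdot>A. \<Pi>x:A. P xs \<rightarrow> P (consL\<cdot>A x xs)) \<rightarrow> P xs\<close>
\<close>

definition elimList :: trm where
  "elimList = \<^bold>\<Lambda>''A''. \<^bold>\<lambda>''xs''. \<^bold>\<Lambda>''P''. \<rho> (\<sigma> Proj2 (Var ''xs'')) -
     (Proj2 (Proj1 (Var ''xs'')) \<cdot> (ListT \<cdot>\<^sub>t TVar ''A'') \<cdot> TVar ''P''
        \<ominus> (nilL \<cdot> TVar ''A'') \<ominus> (consL \<cdot> TVar ''A''))"

definition lengthL :: trm where
  "lengthL = \<^bold>\<Lambda>''A''. \<^bold>\<lambda>''xs''.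
     elimList \<cdot> TVar ''A'' \<bullet> Var ''xs'' \<cdot> (\<^bold>\<lambda>''xs'' : ListT \<cdot>\<^sub>t TVar ''A''. NatT)
       \<bullet> zeroN \<bullet> (\<^bold>\<Lambda>''xs''. \<^bold>\<lambda>''x''. \<^bold>\<lambda>''n''. sucN \<bullet> Var ''n'')"


section \<open>Vectors\<close>

definition VecC :: ty where
  "VecC = \<^bold>\<lambda>''A'' \<Colon> \<star>. \<^bold>\<lambda>''n'' : NatT. \<^bold>\<forall>''X'' \<Colon> NatT \<rightarrow>\<^sub>k \<star>.
     TVar ''X'' \<bullet>\<^sub>v zeroN \<rightarrow>
     (\<^bold>\<forall>''n'' : NatT. TVar ''A'' \<rightarrow> TVar ''X'' \<bullet>\<^sub>v Var ''n'' \<rightarrow> TVar ''X'' \<bullet>\<^sub>v (sucN \<bullet> Var ''n'')) \<rightarrow>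
     TVar ''X'' \<bullet>\<^sub>v Var ''n''"

definition nilCV :: trm where
  "nilCV = \<^bold>\<Lambda>''A''. \<^bold>\<Lambda>''X''. \<^bold>\<lambda>''cN''. \<^bold>\<lambda>''cC''. Var ''cN''"

definition consCV :: trm where
  "consCV = \<^bold>\<Lambda>''A''. \<^bold>\<Lambda>''n''. \<^bold>\<lambda>''x''. \<^bold>\<lambda>''xs''. \<^bold>\<Lambda>''X''. \<^bold>\<lambda>''cN''. \<^bold>\<lambda>''cC''.
     Var ''cC'' \<ominus> Var ''n'' \<bullet> Var ''x'' \<bullet> (Var ''xs'' \<cdot> TVar ''X'' \<bullet> Var ''cN'' \<bullet> Var ''cC'')"

definition VecP :: ty where
  "VecP = \<^bold>\<lambda>''A'' \<Colon> \<star>. \<^bold>\<lambda>''n'' : NatT. \<^bold>\<lambda>''xsC'' : VecC \<cdot>\<^sub>t TVar ''A'' \<bullet>\<^sub>v Var ''n''.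
     \<^bold>\<forall>''X'' \<Colon> NatT \<rightarrow>\<^sub>k \<star>. \<^bold>\<forall>''P'' \<Colon> KPi ''n'' NatT (TVar ''X'' \<bullet>\<^sub>v Var ''n'' \<rightarrow>\<^sub>k \<star>).
     \<^bold>\<forall>''cN'' : TVar ''X'' \<bullet>\<^sub>v zeroN.
     \<^bold>\<forall>''cC'' : (\<^bold>\<forall>''n'' : NatT.
        TVar ''A'' \<rightarrow> TVar ''X'' \<bullet>\<^sub>v Var ''n'' \<rightarrow> TVar ''X'' \<bullet>\<^sub>v (sucN \<bullet> Var ''n'')).
       TVar ''P'' \<bullet>\<^sub>v zeroN \<bullet>\<^sub>v Var ''cN'' \<rightarrow>
       (\<^bold>\<forall>''n'' : NatT. \<^bold>\<forall>''xs'' : TVar ''X'' \<bullet>\<^sub>v Var ''n''. \<^bold>\<Pi>''x'' : TVar ''A''.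
          TVar ''P'' \<bullet>\<^sub>v Var ''n'' \<bullet>\<^sub>v Var ''xs'' \<rightarrow>
          TVar ''P'' \<bullet>\<^sub>v (sucN \<bullet> Var ''n'') \<bullet>\<^sub>v
            (Var ''cC'' \<ominus> Var ''n'' \<bullet> Var ''x'' \<bullet> Var ''xs'')) \<rightarrow>
       TVar ''P'' \<bullet>\<^sub>v Var ''n'' \<bullet>\<^sub>v (Var ''xsC'' \<cdot> TVar ''X'' \<bullet> Var ''cN'' \<bullet> Var ''cC'')"

definition VecR :: ty where
  "VecR = \<^bold>\<lambda>''A'' \<Colon> \<star>. \<^bold>\<lambda>''n'' : NatT. \<^bold>\<lambda>''xsC'' : VecC \<cdot>\<^sub>t TVar ''A'' \<bullet>\<^sub>v Var ''n''.
     Var ''xsC'' \<cdot> (VecC \<cdot>\<^sub>t TVar ''A'') \<bullet> (nilCV \<cdot> TVar ''A'') \<bullet> (consCV \<cdot> TVar ''A'')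
       \<simeq> Var ''xsC''"

definition VecT :: ty where
  "VecT = \<^bold>\<lambda>''A'' \<Colon> \<star>. \<^bold>\<lambda>''n'' : NatT.
     \<^bold>\<iota>''xs'' : (\<^bold>\<iota>''xsC'' : VecC \<cdot>\<^sub>t TVar ''A'' \<bullet>\<^sub>v Var ''n''.
                  VecP \<cdot>\<^sub>t TVar ''A'' \<bullet>\<^sub>v Var ''n'' \<bullet>\<^sub>v Var ''xsC'').
       VecR \<cdot>\<^sub>t TVar ''A'' \<bullet>\<^sub>v Var ''n'' \<bullet>\<^sub>v Proj1 (Var ''xs'')"

text \<open>
  \<open>mkVec : \<forall>A:\<star>. \<forall>n:Nat. \<Pi>xs:(\<iota>xsC:VecC\<cdot>A n. VecP\<cdot>A n xsC). VecR\<cdot>A n xs.1 \<Rightarrow> Vec\<cdot>A n\<close>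
\<close>

definition mkVec :: trm where
  "mkVec = \<^bold>\<Lambda>''A''. \<^bold>\<Lambda>''n''. \<^bold>\<lambda>''xs''. \<^bold>\<Lambda>''q''.
     \<langle>Var ''xs'', \<rho> (Var ''q'') - \<beta>\<lbrace>Var ''xs''\<rbrace>\<rangle>"


section \<open>The coercion from lists to vectors\<close>

text \<open>
  \<open>l2vC : \<forall>A:\<star>. \<Pi>xs:List\<cdot>A. VecC\<cdot>A (length\<cdot>A xs)\<close>,

  \<open>l2vP : \<forall>A:\<star>. \<Pi>xs:List\<cdot>A. VecP\<cdot>A (length\<cdot>A xs) (l2vC\<cdot>A xs)\<close>,

  \<open>l2vR : \<forall>A:\<star>. \<Pi>xs:List\<cdot>A. VecR\<cdot>A (length\<cdot>A xs) (l2vC\<cdot>A xs)\<close>,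

  \<open>l2v : \<forall>A:\<star>. \<Pi>xs:List\<cdot>A. Vec\<cdot>A (length\<cdot>A xs)\<close>.
\<close>

definition l2vC :: trm where
  "l2vC = \<^bold>\<Lambda>''A''. \<^bold>\<lambda>''xs''. \<^bold>\<Lambda>''X''. \<^bold>\<lambda>''cN''. \<^bold>\<lambda>''cC''.
     elimList \<cdot> TVar ''A'' \<bullet> Var ''xs''
       \<cdot> (\<^bold>\<lambda>''xs'' : ListT \<cdot>\<^sub>t TVar ''A''. TVar ''X'' \<bullet>\<^sub>v (lengthL \<cdot> TVar ''A'' \<bullet> Var ''xs''))
       \<bullet> Var ''cN''
       \<bullet> (\<^bold>\<Lambda>''xs''. Var ''cC'' \<ominus> (lengthL \<cdot> TVar ''A'' \<bullet> Var ''xs''))"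

definition l2vP :: trm where
  "l2vP = \<^bold>\<Lambda>''A''. \<^bold>\<lambda>''xs''. \<^bold>\<Lambda>''X''. \<^bold>\<Lambda>''P''. \<^bold>\<Lambda>''cN''. \<^bold>\<Lambda>''cC''. \<^bold>\<lambda>''pN''. \<^bold>\<lambda>''pC''.
     elimList \<cdot> TVar ''A'' \<bullet> Var ''xs''
       \<cdot> (\<^bold>\<lambda>''xs'' : ListT \<cdot>\<^sub>t TVar ''A''. TVar ''P'' \<bullet>\<^sub>v (lengthL \<cdot> TVar ''A'' \<bullet> Var ''xs'')
             \<bullet>\<^sub>v (l2vC \<cdot> TVar ''A'' \<bullet> Var ''xs'' \<cdot> TVar ''X'' \<bullet> Var ''cN'' \<bullet> Var ''cC''))
       \<bullet> Var ''pN''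
       \<bullet> (\<^bold>\<Lambda>''xs''. Var ''pC'' \<ominus> (lengthL \<cdot> TVar ''A'' \<bullet> Var ''xs'')
             \<ominus> (l2vC \<cdot> TVar ''A'' \<bullet> Var ''xs'' \<cdot> TVar ''X'' \<bullet> Var ''cN'' \<bullet> Var ''cC''))"

definition l2vR :: trm where
  "l2vR = \<^bold>\<Lambda>''A''. \<^bold>\<lambda>''xs''. Proj2 (Var ''xs'')"

definition l2v :: trm where
  "l2v = \<^bold>\<Lambda>''A''. \<^bold>\<lambda>''xs''.
     mkVec \<cdot> TVar ''A'' \<ominus> (lengthL \<cdot> TVar ''A'' \<bullet> Var ''xs'')
       \<bullet> \<langle>l2vC \<cdot> TVar ''A'' \<bullet> Var ''xs'', l2vP \<cdot> TVar ''A'' \<bullet> Var ''xs''\<rangle>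
       \<ominus> (l2vR \<cdot> TVar ''A'' \<bullet> Var ''xs'')"

end

theory Submission
  imports Defs
begin

text \<open>A list and the vector built from it differ only in annotations. Erased,
  \<open>elimList\<close> is the identity (\<open>erase_elimList\<close>), so \<open>l2vC\<close>
  merely passes \<open>cN\<close> and \<open>cC\<close> on to its argument and eta-contracts to the
  identity (\<open>erase_l2vC\<close>). Erasing \<open>mkVec\<close> leaves an identity as well, and
  \<open>l2v\<close> is a composition of the two.\<close>

lemma beta_id: "LApp (LLam x (LVar x)) s =\<^sub>\<alpha>\<^sub>\<beta>\<^sub>\<eta> s"
  using beta[of s x "LVar x"] by simp

lemma alpha_id: "LLam x (LVar x) =\<^sub>\<alpha>\<^sub>\<beta>\<^sub>\<eta> LLam y (LVar y)"
proof (cases "y = x")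
  case True
  then show ?thesis by (simp add: abe_eq.refl)
next
  case False
  then show ?thesis using alpha[of y "LVar x" x] by simp
qed

lemma eta2:
  assumes "x \<noteq> y" "x \<notin> FV t" "y \<notin> FV t"
  shows "LLam x (LLam y (LApp (LApp t (LVar x)) (LVar y))) =\<^sub>\<alpha>\<^sub>\<beta>\<^sub>\<eta> t"
proof -
  have "LLam y (LApp (LApp t (LVar x)) (LVar y)) =\<^sub>\<alpha>\<^sub>\<beta>\<^sub>\<eta> LApp t (LVar x)"
    using assms by (intro eta) auto
  then show ?thesis
    using assms by (blast intro: abe_eq.lam abe_eq.trans eta)
qed

text \<open>Erasure keeps only the body of the rewrite, and there drops projections and implicit
  arguments: an erased list is its own eliminator.\<close>

lemma erase_elimList: "erase elimList = LLam ''xs'' (LVar ''xs'')"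
  by (simp add: elimList_def)

lemma erase_l2vC: "erase l2vC =\<^sub>\<alpha>\<^sub>\<beta>\<^sub>\<eta> LLam ''xs'' (LVar ''xs'')"
proof -
  \<comment> \<open>The erasure of \<open>elimList\<close> applied to \<open>xs\<close>, left as a
    redex to match the unfolded \<open>l2vC\<close>. The step argument erases to plain
    \<open>cC\<close>, which makes eta apply.\<close>
  let ?t = "LApp (LLam ''xs'' (LVar ''xs'')) (LVar ''xs'')"
  have "LLam ''cN'' (LLam ''cC'' (LApp (LApp ?t (LVar ''cN'')) (LVar ''cC''))) =\<^sub>\<alpha>\<^sub>\<beta>\<^sub>\<eta> ?t"
    by (rule eta2) auto
  then have "LLam ''cN'' (LLam ''cC'' (LApp (LApp ?t (LVar ''cN'')) (LVar ''cC''))) =\<^sub>\<alpha>\<^sub>\<beta>\<^sub>\<eta> LVar ''xs''"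
    by (blast intro: abe_eq.trans beta_id)
  then show ?thesis
    by (simp add: l2vC_def erase_elimList abe_eq.lam)
qed

theorem theorem3p7:
  shows "erase l2v =\<^sub>\<alpha>\<^sub>\<beta>\<^sub>\<eta> LLam ''x'' (LVar ''x'')"
proof -
  have "LApp (erase l2vC) (LVar ''xs'') =\<^sub>\<alpha>\<^sub>\<beta>\<^sub>\<eta> LVar ''xs''"
    by (blast intro: abe_eq.trans abe_eq.app abe_eq.refl erase_l2vC beta_id)
  \<comment> \<open>The outer identity is the erased \<open>mkVec\<close>; its argument is the pair,
    which erases to its \<open>l2vC\<close> component.\<close>
  then have "LApp (LLam ''xs'' (LVar ''xs'')) (LApp (erase l2vC) (LVar ''xs'')) =\<^sub>\<alpha>\<^sub>\<beta>\<^sub>\<eta> LVar ''xs''"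
    by (blast intro: abe_eq.trans beta_id)
  then have "erase l2v =\<^sub>\<alpha>\<^sub>\<beta>\<^sub>\<eta> LLam ''xs'' (LVar ''xs'')"
    by (simp add: l2v_def mkVec_def abe_eq.lam)
  then show ?thesis
    by (rule abe_eq.trans) (rule alpha_id)
qed

end
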